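(* Let $A=T[0,a_1,\dots,a_{n-1}]$ be a symmetric Boolean Toeplitz matrix of order $n$ with zero main diagonal and with $S_A\neq\emptyset$. Suppose $2s_0>n$, where $s_0=\min S_A$, and let $m=2s_0-n$. Then $$G(A)\cong G(T[a_m,\dots,a_{n-1}])\cup I_m ,$$ which implies that $G(A)$ has $m$ more connected components than $G(T[a_m,\dots,a_{n-1}])$.
   Context: For $a_0,\dots,a_{n-1}$, $T[a_0,a_1,\dots,a_{n-1}]$ denotes the symmetric Toeplitz matrix of order $n$ whose $(i,j)$ entry is $a_{|i-j|}$, $i,j\in[n]=\{1,\dots,n\}$; in particular $T[a_m,\dots,a_{n-1}]$ has order $n-m$ and first row $(a_m,\dots,a_{n-1})$. Boolean means all entries are in $\{0,1\}$. For such a matrix $A$ of order $n$, $S_A=\{i\in\{0,\dots,n-1\}: a_i\neq0\}$, and $G(A)$ is the graph with vertex set $[n]$ in which $i$ and $j$ are adjacent if and only if $|i-j|\in S_A$ (all edges having weight $1$). $I_m$ denotes the graph with $m$ vertices and no edges, and $\cup$ denotes disjoint union of graphs. *)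

theory Defs
  imports
    "Jordan_Normal_Form.Matrix"
    "Graph_Theory.Digraph_Component"
    "Graph_Theory.Digraph_Isomorphism"
begin

text \<open>
  The symmetric Toeplitz matrix \<open>T[a\<^sub>0, \<dots>, a\<^sub>n\<^sub>-\<^sub>1]\<close> is given by the list of its entries, so
  its order is the length of the list. Matrix positions are counted from 0, which does not
  affect the entries because they depend on the difference of the indices only.
\<close>

definition toeplitz :: "'a list \<Rightarrow> 'a mat" where
  "toeplitz xs = mat (length xs) (length xs) (\<lambda>(i, j). xs ! nat \<bar>int i - int j\<bar>)"

lemma toeplitz_carrier: "toeplitz xs \<in> carrier_mat (length xs) (length xs)"
  by (simp add: toeplitz_def)

lemma toeplitz_symmetric: "transpose_mat (toeplitz xs) = toeplitz xs"
  by (rule eq_matI) (auto simp: toeplitz_def abs_minus_commute)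

lemma toeplitz_first_row: "i < length xs \<Longrightarrow> toeplitz xs $$ (0, i) = xs ! i"
  by (subst toeplitz_def, subst index_mat(1)) auto

definition boolean_mat :: "'a::zero_neq_one mat \<Rightarrow> bool" where
  "boolean_mat A \<longleftrightarrow> elements_mat A \<subseteq> {0, 1}"

text \<open>
  \<open>S\<^sub>A\<close> for a symmetric Toeplitz matrix \<open>A\<close>, whose parameter \<open>a\<^sub>i\<close> is the entry of the first
  row at offset \<open>i\<close>.
\<close>

definition offset_set :: "'a::zero mat \<Rightarrow> nat set" where
  "offset_set A = {i. i < dim_row A \<and> A $$ (0, i) \<noteq> 0}"

lemma offset_set_toeplitz: "offset_set (toeplitz xs) = {i. i < length xs \<and> xs ! i \<noteq> 0}"
  using toeplitz_carrier[of xs] by (auto simp: offset_set_def toeplitz_first_row)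

text \<open>
  Undirected graphs are represented, as usual for this graph library, by digraphs
  containing both orientations of every edge.
\<close>

definition toeplitz_graph :: "'a::zero mat \<Rightarrow> nat pair_pre_digraph" where
  "toeplitz_graph A =
    \<lparr> pverts = {1..dim_row A},
      parcs = {(i, j). i \<in> {1..dim_row A} \<and> j \<in> {1..dim_row A} \<and>
                       nat \<bar>int i - int j\<bar> \<in> offset_set A} \<rparr>"

lemma toeplitz_graph_is_graph:
  assumes "0 \<notin> offset_set A"
  shows "pair_graph (toeplitz_graph A)"
proof
  show "finite (parcs (toeplitz_graph A))"
    by (rule finite_subset[of _ "{1..dim_row A} \<times> {1..dim_row A}"])
      (auto simp: toeplitz_graph_def)
  show "symmetric (toeplitz_graph A)"
    by (auto simp: toeplitz_graph_def symmetric_def abs_minus_commute intro!: symI)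
qed (use assms in \<open>auto simp: toeplitz_graph_def\<close>)

definition empty_graph :: "nat \<Rightarrow> nat pair_pre_digraph" where
  "empty_graph m = \<lparr> pverts = {1..m}, parcs = {} \<rparr>"

definition disjoint_union ::
    "'a pair_pre_digraph \<Rightarrow> 'b pair_pre_digraph \<Rightarrow> ('a + 'b) pair_pre_digraph" where
  "disjoint_union G H =
    \<lparr> pverts = pverts G <+> pverts H,
      parcs = map_prod Inl Inl ` parcs G \<union> map_prod Inr Inr ` parcs H \<rparr>"

text \<open>
  The maximal connected subgraphs. For symmetric digraphs they coincide with the strongly
  connected components, cf. \<open>pre_digraph.sccs_altdef2\<close>.
\<close>

definition components :: "('a, 'b) pre_digraph \<Rightarrow> ('a, 'b) pre_digraph set" where
  "components G = {H. pre_digraph.max_subgraph G connected H}"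

lemma finite_components:
  assumes "finite (verts G)" "finite (arcs G)"
  shows "finite (components G)"
proof (rule finite_subset)
  show "components G \<subseteq> (\<lambda>(V, E). \<lparr> verts = V, arcs = E, tail = tail G, head = head G \<rparr>) `
      (Pow (verts G) \<times> Pow (arcs G))"
  proof
    fix H assume "H \<in> components G"
    then have "subgraph H G"
      by (simp add: components_def pre_digraph.max_subgraph_def)
    then have "(verts H, arcs H) \<in> Pow (verts G) \<times> Pow (arcs G)"
      and "H = \<lparr> verts = verts H, arcs = arcs H, tail = tail G, head = head G \<rparr>"
      by (auto simp: subgraph_def compatible_def)
    then show "H \<in> (\<lambda>(V, E). \<lparr> verts = V, arcs = E, tail = tail G, head = head G \<rparr>) `
      (Pow (verts G) \<times> Pow (arcs G))"
      by force
  qed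
qed (use assms in simp)

end

theory Submission
  imports Defs
begin

text \<open>
  Let \<open>s\<^sub>0\<close> be the smallest offset of \<open>A\<close>. A vertex \<open>i\<close> with \<open>n - s\<^sub>0 < i \<le> s\<^sub>0\<close> lies at distance
  less than \<open>s\<^sub>0\<close> from both ends of \<open>{1..n}\<close>, hence from every vertex, and so it is isolated.
  There are \<open>s\<^sub>0 - (n - s\<^sub>0) = m\<close> such vertices. The others form the low block \<open>{1..n - s\<^sub>0}\<close> and
  the high block \<open>{s\<^sub>0 + 1..n}\<close>. Each block has diameter less than \<open>n - s\<^sub>0 < s\<^sub>0\<close>, so edges only run
  between the two. Deleting the isolated vertices and closing the gap of width \<open>m\<close> therefore
  shortens every edge by exactly \<open>m\<close>, so that the offset \<open>k\<close> of the smaller graph stands for the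
  offset \<open>m + k\<close> of the larger one. These are the offsets of \<open>T[a\<^sub>m, \<dots>, a\<^sub>n\<^sub>-\<^sub>1]\<close>, and the
  relabelling is the isomorphism of \<open>toeplitz_graph_iso_disjoint_union\<close>.

  For the number of components, the maximal connected subgraphs of a symmetric digraph are its
  strongly connected components (\<open>components_eq_sccs\<close>), whose number is known to be invariant
  under isomorphism and equals the number of distinct sets of vertices reachable from a vertex.
  The latter count is visibly additive over disjoint unions
  (\<open>card_components_disjoint_union\<close>), and each vertex of an edgeless graph contributes one.
\<close>

section \<open>Components of symmetric digraphs\<close>

lemma arc_mono_connected: "arc_mono connected"
  unfolding arc_mono_def
proof (intro allI impI, elim conjE)
  fix H1 H2 :: "('a, 'b) pre_digraph"
  assume "connected H1" "subgraph H1 H2" "verts H1 = verts H2"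
  then show "connected H2"
    by (intro wf_digraph.connected_spanning_imp_connected[of H2 H1])
      (auto simp: spanning_def)
qed

lemma strongly_connected_imp_connected:
  assumes "strongly_connected G" shows "connected G"
proof -
  have "rtrancl_on (verts G) (arcs_ends G) \<subseteq> rtrancl_on (verts G) ((arcs_ends G)\<^sup>s)"
    by (rule subrelI) (auto elim!: rtrancl_on_mono[rotated 2] simp: symcl_def)
  with assms show ?thesis
    by (auto simp: connected_conv strongly_connected_def reachable_def)
qed

text \<open>
  Connected and strongly connected agree for induced subgraphs, which inherit symmetry from \<open>G\<close>,
  but not for arbitrary subgraphs, which may contain only one orientation of an edge. Maximality
  is what reduces the general case to the induced one: adding all arcs of \<open>G\<close> between the
  given vertices keeps a subgraph connected.
\<close>

lemma (in sym_digraph) components_eq_sccs: "components G = sccs"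
proof -
  have strong: "strongly_connected H" if "induced_subgraph H G" "connected H" for H
  proof -
    have "symmetric H"
      using sym_arcs that(1) by (rule induced_graph_imp_symmetric)
    moreover have "wf_digraph H"
      using that(1) by (rule wf_digraphI_induced)
    ultimately show ?thesis
      using that(2) by (simp add: wf_digraph.symmetric_connected_imp_strongly_connected)
  qed
  have "max_subgraph connected H \<longleftrightarrow> max_subgraph strongly_connected H" for H
  proof
    assume max: "max_subgraph connected H"
    have "induced_subgraph H G"
      using max arc_mono_connected by (rule induced_subgraphI_arc_mono)
    then have "strongly_connected H"
      using strong max_subgraph_prop[OF max] by blast
    then show "max_subgraph strongly_connected H"
      using max by (auto simp: max_subgraph_def strongly_connected_imp_connected)
  next
    assume max: "max_subgraph strongly_connected H"
    \<comment> \<open>A larger connected \<open>K\<close> need not be symmetric, so it is compared with \<open>H\<close> only after it has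
      been filled up to an induced subgraph.\<close>
    have "\<not> connected K" if K: "H \<noteq> K" "subgraph H K" "subgraph K G" for K
    proof
      let ?K = "G \<restriction> verts K"
      assume "connected K"
      have K': "subgraph K ?K" "subgraph ?K G" "induced_subgraph ?K G" "verts K = verts ?K"
        using K by (auto simp: subgraph_induce_subgraphI2 subgraph_induce_subgraphI)
      have "connected ?K"
        using arc_mono_connected \<open>connected K\<close> K' unfolding arc_mono_def by blast
      then have "strongly_connected ?K"
        using strong K' by blast
      moreover have "subgraph H ?K"
        using K K' subgraph_trans by blast
      ultimately have "?K = H"
        using max K' by (auto simp: max_subgraph_def)
      then have "H = K"
        using K K' by (intro pre_digraph.equality) (auto simp: subgraph_def compatible_def)
      with K show False by simp
    qed
    then show "max_subgraph connected H"
      using max by (auto simp: max_subgraph_def strongly_connected_imp_connected)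
  qed
  then show ?thesis
    by (simp add: components_def sccs_altdef2)
qed

lemma card_components_iso:
  assumes G: "sym_digraph G" and H: "sym_digraph H" and iso: "digraph_iso G H"
  shows "card (components G) = card (components H)"
proof -
  obtain f where f: "pre_digraph.digraph_isomorphism G f" and [simp]: "H = app_iso f G"
    using iso by (auto simp: digraph_iso_def)
  show ?thesis
    using sym_digraph.components_eq_sccs[OF G] sym_digraph.components_eq_sccs[OF H]
    by (simp add: sccs_iso[OF f] card_sccs_iso[OF f])
qed

text \<open>
  Passing from subgraphs to sets of vertices makes components comparable between graphs of
  different type by taking images.
\<close>

lemma (in sym_digraph) card_components_conv_reachable:
  "card (components G) = card ((\<lambda>u. {v. u \<rightarrow>\<^sup>* v}) ` verts G)"
proof -
  have "scc_of u = {v. u \<rightarrow>\<^sup>* v}" for u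
    by (auto simp: scc_of_def symmetric_reachable[OF sym_arcs])
  then show ?thesis
    using card_sccs_verts by (simp add: components_eq_sccs sccs_verts_conv_scc_of)
qed

section \<open>Disjoint unions and edgeless graphs\<close>

text \<open>
  Pseudo graphs, which may have loops, are the right class here: the diagonal entry \<open>a\<^sub>m\<close> of
  \<open>T[a\<^sub>m, \<dots>, a\<^sub>n\<^sub>-\<^sub>1]\<close> vanishes only if \<open>m\<close> is not an offset of the larger matrix.
\<close>

lemma pair_pseudo_graph_toeplitz_graph: "pair_pseudo_graph (toeplitz_graph A)"
proof
  show "finite (parcs (toeplitz_graph A))"
    by (rule finite_subset[of _ "{1..dim_row A} \<times> {1..dim_row A}"])
      (auto simp: toeplitz_graph_def)
  show "symmetric (toeplitz_graph A)"
    by (auto simp: toeplitz_graph_def symmetric_def abs_minus_commute intro!: symI)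
qed (auto simp: toeplitz_graph_def)

lemma pair_pseudo_graph_empty_graph: "pair_pseudo_graph (empty_graph m)"
  by unfold_locales (auto simp: empty_graph_def symmetric_def intro: symI)

lemma pair_pseudo_graph_disjoint_union:
  assumes "pair_pseudo_graph G" "pair_pseudo_graph H"
  shows "pair_pseudo_graph (disjoint_union G H)"
proof -
  interpret G: pair_pseudo_graph G by fact
  interpret H: pair_pseudo_graph H by fact
  show ?thesis
  proof
    show "symmetric (disjoint_union G H)"
      by (auto simp: disjoint_union_def symmetric_def intro!: symI
          dest: G.arcs_symmetric H.arcs_symmetric)
  qed (auto simp: disjoint_union_def G.pair_finite_verts H.pair_finite_verts
      G.pair_finite_arcs H.pair_finite_arcs dest: G.wellformed' H.wellformed')
qed

lemma pair_pseudo_graph_imp_sym_digraph: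
  assumes "pair_pseudo_graph G" shows "sym_digraph (with_proj G)"
proof -
  interpret pair_pseudo_graph G by fact
  show ?thesis by unfold_locales
qed

text \<open>
  No arc of \<open>H\<close> leaves the image of \<open>G\<close>, so a walk that starts in the image stays there and can
  be pulled back arc by arc. Both injections into a disjoint union are of this kind.
\<close>

lemma reachable_closed_embedding:
  assumes "wf_digraph (with_proj G)" "wf_digraph (with_proj H)"
    and u: "u \<in> pverts G" and emb: "f ` pverts G \<subseteq> pverts H"
    and arcs: "\<And>v y. v \<in> pverts G \<Longrightarrow> (f v, y) \<in> parcs H \<longleftrightarrow> (\<exists>w. y = f w \<and> (v, w) \<in> parcs G)"
  shows "{y. f u \<rightarrow>\<^sup>*\<^bsub>with_proj H\<^esub> y} = f ` {v. u \<rightarrow>\<^sup>*\<^bsub>with_proj G\<^esub> v}"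
proof -
  interpret G: wf_digraph "with_proj G" by fact
  interpret H: wf_digraph "with_proj H" by fact
  have "\<exists>v. y = f v \<and> u \<rightarrow>\<^sup>*\<^bsub>with_proj G\<^esub> v" if "f u \<rightarrow>\<^sup>*\<^bsub>with_proj H\<^esub> y" for y
    using that
  proof (induction rule: H.reachable_induct)
    case base
    then show ?case using u by auto
  next
    case (step x y)
    then obtain v where v: "x = f v" "u \<rightarrow>\<^sup>*\<^bsub>with_proj G\<^esub> v" by blast
    then have "v \<in> pverts G" using G.reachable_in_verts by auto
    with step v arcs obtain w where "y = f w" "(v, w) \<in> parcs G" by auto
    with v have "u \<rightarrow>\<^sup>*\<^bsub>with_proj G\<^esub> w" by (auto intro: G.reachable_adj_trans)
    with \<open>y = f w\<close> show ?case by blast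
  qed
  moreover have "f u \<rightarrow>\<^sup>*\<^bsub>with_proj H\<^esub> f v" if "u \<rightarrow>\<^sup>*\<^bsub>with_proj G\<^esub> v" for v
    using that
  proof (induction rule: G.reachable_induct)
    case base
    then show ?case using emb by auto
  next
    case (step x y)
    then have "x \<in> pverts G" using G.reachable_in_verts by auto
    with step arcs have "(f x, f y) \<in> parcs H" by auto
    with step show ?case by (auto intro: H.reachable_adj_trans)
  qed
  ultimately show ?thesis by blast
qed

lemma card_components_disjoint_union:
  fixes G :: "'a pair_pre_digraph" and H :: "'b pair_pre_digraph"
  assumes G: "pair_pseudo_graph G" and H: "pair_pseudo_graph H"
  shows "card (components (with_proj (disjoint_union G H))) =
    card (components (with_proj G)) + card (components (with_proj H))"
proof -
  let ?U = "disjoint_union G H"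
  let ?L = "image Inl :: 'a set \<Rightarrow> ('a + 'b) set" and ?R = "image Inr :: 'b set \<Rightarrow> ('a + 'b) set"
  define RG where "RG = (\<lambda>u. {v. u \<rightarrow>\<^sup>*\<^bsub>with_proj G\<^esub> v}) ` pverts G"
  define RH where "RH = (\<lambda>u. {v. u \<rightarrow>\<^sup>*\<^bsub>with_proj H\<^esub> v}) ` pverts H"
  interpret G: pair_pseudo_graph G by fact
  interpret H: pair_pseudo_graph H by fact
  interpret U: pair_pseudo_graph ?U
    using G H by (rule pair_pseudo_graph_disjoint_union)
  have l: "{y. Inl u \<rightarrow>\<^sup>*\<^bsub>with_proj ?U\<^esub> y} = Inl ` {v. u \<rightarrow>\<^sup>*\<^bsub>with_proj G\<^esub> v}" if "u \<in> pverts G" for u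
    using that by (intro reachable_closed_embedding G.wf_digraph_axioms U.wf_digraph_axioms)
      (force simp: disjoint_union_def)+
  have r: "{y. Inr u \<rightarrow>\<^sup>*\<^bsub>with_proj ?U\<^esub> y} = Inr ` {v. u \<rightarrow>\<^sup>*\<^bsub>with_proj H\<^esub> v}" if "u \<in> pverts H" for u
    using that by (intro reachable_closed_embedding H.wf_digraph_axioms U.wf_digraph_axioms)
      (force simp: disjoint_union_def)+
  have "(\<lambda>u. {v. u \<rightarrow>\<^sup>*\<^bsub>with_proj ?U\<^esub> v}) ` pverts ?U = ?L ` RG \<union> ?R ` RH"
  proof -
    have "pverts ?U = Inl ` pverts G \<union> Inr ` pverts H"
      by (auto simp: disjoint_union_def)
    then show ?thesis
      by (simp add: RG_def RH_def image_Un image_image l r cong: image_cong_simp)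
  qed
  moreover have "card (?L ` RG \<union> ?R ` RH) = card RG + card RH"
  proof -
    \<comment> \<open>Images under \<open>Inl\<close> and \<open>Inr\<close> could only coincide if both were empty, but a reachability
      class contains its starting vertex.\<close>
    have "S \<noteq> {}" if "S \<in> RG" for S using that by (auto simp: RG_def)
    then have "?L ` RG \<inter> ?R ` RH = {}" by blast
    moreover have "finite RG" "finite RH"
      by (simp_all add: RG_def RH_def G.pair_finite_verts H.pair_finite_verts)
    moreover have "card (?L ` RG) = card RG" "card (?R ` RH) = card RH"
      by (auto intro!: card_image inj_onI simp: inj_image_eq_iff)
    ultimately show ?thesis by (simp add: card_Un_disjoint)
  qed
  ultimately show ?thesis
    using sym_digraph.card_components_conv_reachable[OF pair_pseudo_graph_imp_sym_digraph[OF G]]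
      sym_digraph.card_components_conv_reachable[OF pair_pseudo_graph_imp_sym_digraph[OF H]]
      sym_digraph.card_components_conv_reachable[OF
        pair_pseudo_graph_imp_sym_digraph[OF U.pair_pseudo_graph]]
    by (simp add: RG_def RH_def)
qed

lemma card_components_empty_graph: "card (components (with_proj (empty_graph m))) = m"
proof -
  interpret pair_pseudo_graph "empty_graph m"
    by (rule pair_pseudo_graph_empty_graph)
  have "{v. u \<rightarrow>\<^sup>*\<^bsub>with_proj (empty_graph m)\<^esub> v} = {u}" if "u \<in> pverts (empty_graph m)" for u
    using that reachable_conv'[of u] by (auto simp: empty_graph_def)
  then have "card (components (with_proj (empty_graph m))) = card ((\<lambda>u. {u}) ` {1..m})"
    using sym_digraph.card_components_conv_reachable[OF
        pair_pseudo_graph_imp_sym_digraph[OF pair_pseudo_graph]]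
    by (simp add: empty_graph_def cong: image_cong_simp)
  also have "\<dots> = m" by (simp add: card_image)
  finally show ?thesis .
qed

section \<open>Splitting off the isolated vertices of a Toeplitz graph\<close>

lemma digraph_iso_with_projI:
  assumes G: "wf_digraph (with_proj G)" and H: "wf_digraph (with_proj H)"
    and bij: "bij_betw f (pverts G) (pverts H)"
    and arcs: "\<And>u v. u \<in> pverts G \<Longrightarrow> v \<in> pverts G \<Longrightarrow>
      (f u, f v) \<in> parcs H \<longleftrightarrow> (u, v) \<in> parcs G"
  shows "digraph_iso (with_proj G) (with_proj H)"
proof -
  interpret G: pair_wf_digraph G using G by (simp add: wf_digraph_wp_iff)
  interpret H: pair_wf_digraph H using H by (simp add: wf_digraph_wp_iff)
  let ?h = "\<lparr>iso_verts = f, iso_arcs = map_prod f f, iso_head = snd, iso_tail = fst\<rparr>"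
  have inj: "inj_on f (pverts G)" and img: "f ` pverts G = pverts H"
    using bij by (auto simp: bij_betw_def)
  have "inj_on (map_prod f f) (parcs G)"
    by (rule inj_on_subset[OF map_prod_inj_on[OF inj inj]]) (auto dest: G.wellformed')
  then have "pre_digraph.digraph_isomorphism (with_proj G) ?h"
    using G inj by (simp add: pre_digraph.digraph_isomorphism_def)
  moreover have "map_prod f f ` parcs G = parcs H"
  proof (intro equalityI subsetI)
    fix e assume "e \<in> map_prod f f ` parcs G"
    then show "e \<in> parcs H" using arcs by (auto dest: G.wellformed')
  next
    fix e assume e: "e \<in> parcs H"
    then have "fst e \<in> f ` pverts G" "snd e \<in> f ` pverts G"
      using img H.arc_fst_in_verts H.arc_snd_in_verts by auto
    then obtain u v where "u \<in> pverts G" "v \<in> pverts G" "e = (f u, f v)"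
      by (metis imageE prod.collapse)
    with e arcs show "e \<in> map_prod f f ` parcs G" by force
  qed
  then have "with_proj H = app_iso ?h (with_proj G)"
    using img by (simp add: app_iso_def with_proj_def)
  ultimately show ?thesis by (auto simp: digraph_iso_def)
qed

text \<open>
  The isomorphism \<open>f\<close> fixes the low block, moves the high block down by \<open>m\<close> so that it
  follows the low one without a gap, and numbers the vertices in between, which are isolated,
  from 1 on. Two vertices in the same block are not adjacent on either side: after adding \<open>m\<close>, their distance,
  at most \<open>n - s0 - 1\<close>, is still below \<open>s0\<close>.
\<close>

lemma toeplitz_graph_iso_disjoint_union:
  assumes dims: "dim_row A = n" "dim_row B = n - m"
    and s0: "\<And>k. k \<in> offset_set A \<Longrightarrow> s0 \<le> k" "s0 \<le> n" "n < 2 * s0" "m = 2 * s0 - n"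
    and shift: "\<And>k. k \<in> offset_set B \<longleftrightarrow> m + k \<in> offset_set A"
  shows "digraph_iso (with_proj (toeplitz_graph A))
    (with_proj (disjoint_union (toeplitz_graph B) (empty_graph m)))"
proof -
  let ?G = "toeplitz_graph A" and ?U = "disjoint_union (toeplitz_graph B) (empty_graph m)"
  define f :: "nat \<Rightarrow> nat + nat" where
    "f i = (if i \<le> n - s0 then Inl i else if s0 < i then Inl (i - m) else Inr (i - (n - s0)))" for i
  define g :: "nat + nat \<Rightarrow> nat" where
    "g x = (case x of Inl i \<Rightarrow> if i \<le> n - s0 then i else i + m | Inr i \<Rightarrow> i + (n - s0))" for x
  have vU: "pverts ?U = {1..n - m} <+> {1..m}"
    by (simp add: disjoint_union_def toeplitz_graph_def empty_graph_def dims)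
  have vG: "pverts ?G = {1..n}"
    by (simp add: toeplitz_graph_def dims)
  have "bij_betw f (pverts ?G) (pverts ?U)"
    unfolding vU vG
    by (rule bij_betw_byWitness[of _ g]) (use s0(2-4) in \<open>auto simp: f_def g_def split: if_splits\<close>)
  moreover have "(f u, f v) \<in> parcs ?U \<longleftrightarrow> (u, v) \<in> parcs ?G"
    if uv: "u \<in> pverts ?G" "v \<in> pverts ?G" for u v
  proof -
    have G: "(u, v) \<in> parcs ?G \<longleftrightarrow> nat \<bar>int u - int v\<bar> \<in> offset_set A"
      using uv by (simp add: toeplitz_graph_def)
    have UI: "(Inl i, Inl j) \<in> parcs ?U \<longleftrightarrow> m + nat \<bar>int i - int j\<bar> \<in> offset_set A"
      if "i \<in> {1..n - m}" "j \<in> {1..n - m}" for i j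
      using that by (auto simp: disjoint_union_def toeplitz_graph_def empty_graph_def dims
          simp flip: shift)
    have UN: "(Inr i, y) \<notin> parcs ?U" "(y, Inr i) \<notin> parcs ?U" for i y
      by (auto simp: disjoint_union_def empty_graph_def)
    have low: "f i = Inl i" "i \<in> {1..n - m}" if "i \<in> pverts ?G" "i \<le> n - s0" for i
      using that s0(2-4) by (auto simp: f_def vG)
    have high: "f i = Inl (i - m)" "i - m \<in> {1..n - m}" if "i \<in> pverts ?G" "s0 < i" for i
      using that s0(2-4) by (auto simp: f_def vG)
    have small: "k \<notin> offset_set A" if "k < s0" for k
      using that s0(1)[of k] by auto
    consider (near) "u \<le> n - s0" "v \<le> n - s0" | (far) "s0 < u" "s0 < v"
      | (up) "u \<le> n - s0" "s0 < v" | (down) "s0 < u" "v \<le> n - s0"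
      | (iso1) "n - s0 < u" "u \<le> s0" | (iso2) "n - s0 < v" "v \<le> s0"
      by linarith
    then show ?thesis
    proof cases
      case near
      then have "m + nat \<bar>int u - int v\<bar> < s0" "nat \<bar>int u - int v\<bar> < s0"
        using uv s0(2-4) by (auto simp: vG)
      moreover have "(f u, f v) \<in> parcs ?U \<longleftrightarrow> m + nat \<bar>int u - int v\<bar> \<in> offset_set A"
        using near uv by (simp only: low UI)
      ultimately show ?thesis using G by (simp add: small)
    next
      case far
      then have "m + nat \<bar>int (u - m) - int (v - m)\<bar> < s0" "nat \<bar>int u - int v\<bar> < s0"
        using uv s0(2-4) by (auto simp: vG)
      moreover have "(f u, f v) \<in> parcs ?U \<longleftrightarrow> m + nat \<bar>int (u - m) - int (v - m)\<bar> \<in> offset_set A"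
        using far uv by (simp only: high UI)
      ultimately show ?thesis using G by (simp add: small)
    next
      case up
      then have "m + nat \<bar>int u - int (v - m)\<bar> = nat \<bar>int u - int v\<bar>"
        using uv s0(2-4) by (auto simp: vG)
      moreover have "(f u, f v) \<in> parcs ?U \<longleftrightarrow> m + nat \<bar>int u - int (v - m)\<bar> \<in> offset_set A"
        using up uv by (simp only: low high UI)
      ultimately show ?thesis using G by (simp only:)
    next
      case down
      then have "m + nat \<bar>int (u - m) - int v\<bar> = nat \<bar>int u - int v\<bar>"
        using uv s0(2-4) by (auto simp: vG)
      moreover have "(f u, f v) \<in> parcs ?U \<longleftrightarrow> m + nat \<bar>int (u - m) - int v\<bar> \<in> offset_set A"
        using down uv by (simp only: low high UI)
      ultimately show ?thesis using G by (simp only:)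
    next
      case iso1
      then have "nat \<bar>int u - int v\<bar> < s0" using uv s0(2-4) by (auto simp: vG)
      with iso1 show ?thesis using G by (simp add: small f_def UN)
    next
      case iso2
      then have "nat \<bar>int u - int v\<bar> < s0" using uv s0(2-4) by (auto simp: vG)
      with iso2 show ?thesis using G by (simp add: small f_def UN)
    qed
  qed
  ultimately show ?thesis
    by (intro digraph_iso_with_projI sym_digraph.axioms(1) pair_pseudo_graph_imp_sym_digraph
        pair_pseudo_graph_disjoint_union pair_pseudo_graph_toeplitz_graph
        pair_pseudo_graph_empty_graph)
qed

theorem theorem3p1:
  fixes a :: "nat \<Rightarrow> real" and n s0 m :: nat and A :: "real mat"
  assumes "n \<ge> 1"
    and "A = toeplitz (0 # map a [1..<n])"
    and "boolean_mat A"
    and "offset_set A \<noteq> {}"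
    and "s0 = Min (offset_set A)"
    and "2 * s0 > n"
    and "m = 2 * s0 - n"
  shows "digraph_iso (with_proj (toeplitz_graph A))
           (with_proj (disjoint_union (toeplitz_graph (toeplitz (map a [m..<n]))) (empty_graph m)))
       \<and> card (components (with_proj (toeplitz_graph A))) =
           card (components (with_proj (toeplitz_graph (toeplitz (map a [m..<n]))))) + m"
proof -
  let ?B = "toeplitz (map a [m..<n])"
  have S: "offset_set A = {k. 0 < k \<and> k < n \<and> a k \<noteq> 0}"
    using assms(1) by (auto simp: assms(2) offset_set_toeplitz nth_Cons' split: if_splits)
  then have fin: "finite (offset_set A)" by simp
  have "s0 \<in> offset_set A" using fin assms(4,5) by simp
  then have "s0 \<le> n" by (simp add: S)
  moreover have "k \<in> offset_set ?B \<longleftrightarrow> m + k \<in> offset_set A" for k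
    using assms(6,7) by (auto simp: S offset_set_toeplitz)
  moreover have "dim_row A = n" "dim_row ?B = n - m"
    using assms(1,2) by (simp_all add: toeplitz_def)
  ultimately have iso: "digraph_iso (with_proj (toeplitz_graph A))
      (with_proj (disjoint_union (toeplitz_graph ?B) (empty_graph m)))"
    using assms(5-7) fin by (intro toeplitz_graph_iso_disjoint_union[of A n ?B m s0]) auto
  have "card (components (with_proj (toeplitz_graph A))) =
      card (components (with_proj (disjoint_union (toeplitz_graph ?B) (empty_graph m))))"
    using iso by (intro card_components_iso pair_pseudo_graph_imp_sym_digraph
        pair_pseudo_graph_disjoint_union pair_pseudo_graph_toeplitz_graph
        pair_pseudo_graph_empty_graph)
  also have "\<dots> = card (components (with_proj (toeplitz_graph ?B))) + m"
    by (simp add: card_components_disjoint_union pair_pseudo_graph_toeplitz_graph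
        pair_pseudo_graph_empty_graph card_components_empty_graph)
  finally show ?thesis using iso by blast
qed

end
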